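(* Let $\Gamma$ be a simple strongly connected digraph with vertex set $X$, adjacency matrix $A$, diameter $D$ and distance-$i$ matrices $A_0=I,A_1=A,\ldots,A_D$. Then $\Gamma$ is a distance-regular digraph if and only if $A^\top\in\{A_0,A_1,\ldots,A_D\}$ and there exist polynomials $p_0,\ldots,p_D$ with $\deg p_i\le i$ and $A_i=p_i(A)$ for $0\le i\le D$.
   Context: $\partial(x,y)$ is the directed distance; $\Gamma^{\rightarrow}_i(x)=\{z\mid\partial(x,z)=i\}$; $(A_i)_{xy}=1$ iff $\partial(x,y)=i$. $\Gamma$ is a distance-regular digraph if there are integers $d^{\rightarrow}_{ij},d^{\leftarrow}_{ij}$ $(0\le i,j\le D)$ such that for every $x\in X$ and every $y\in\Gamma^{\rightarrow}_i(x)$: $|\Gamma^{\rightarrow}_1(y)\cap\Gamma^{\rightarrow}_j(x)|=d^{\rightarrow}_{ij}$ and $|\Gamma^{\leftarrow}_1(y)\cap\Gamma^{\rightarrow}_j(x)|=d^{\leftarrow}_{ij}$, where $\Gamma^{\rightarrow}_1(y)$, $\Gamma^{\leftarrow}_1(y)$ are the out- and in-neighbourhoods of $y$. *)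

theory Defs
  imports
    "HOL-Analysis.Analysis"
    "HOL-Computational_Algebra.Polynomial"
    "Graph_Theory.Arc_Walk"
    "Graph_Theory.Digraph_Component"
begin

text \<open>
  The vertex set is a finite type, so that square matrices indexed by the vertices are
  of type \<open>real ^ 'v ^ 'v\<close>. Arcs may have any type; a simple digraph is an
  instance of the locale \<open>digraph\<close>, which excludes loops and parallel arcs
  but allows a pair of opposite arcs.
\<close>

text \<open>
  The directed distance is meaningful only if \<open>y\<close> is reachable from \<open>x\<close>. This always
  holds in a strongly connected digraph.
\<close>

definition ddist :: "('v, 'e) pre_digraph \<Rightarrow> 'v \<Rightarrow> 'v \<Rightarrow> nat" where
  "ddist G x y = (LEAST n. \<exists>p. pre_digraph.awalk G x p y \<and> length p = n)"

definition digraph_diameter :: "('v, 'e) pre_digraph \<Rightarrow> nat" where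
  "digraph_diameter G = Max {ddist G x y | x y. x \<in> verts G \<and> y \<in> verts G}"

definition out_sphere :: "('v, 'e) pre_digraph \<Rightarrow> nat \<Rightarrow> 'v \<Rightarrow> 'v set" where
  "out_sphere G i x = {z \<in> verts G. ddist G x z = i}"

definition out_nbhd :: "('v, 'e) pre_digraph \<Rightarrow> 'v \<Rightarrow> 'v set" where
  "out_nbhd G y = {z \<in> verts G. y \<rightarrow>\<^bsub>G\<^esub> z}"

definition in_nbhd :: "('v, 'e) pre_digraph \<Rightarrow> 'v \<Rightarrow> 'v set" where
  "in_nbhd G y = {z \<in> verts G. z \<rightarrow>\<^bsub>G\<^esub> y}"

definition distance_regular :: "('v, 'e) pre_digraph \<Rightarrow> bool" where
  "distance_regular G \<longleftrightarrow>
    (\<exists>(d_out :: nat \<Rightarrow> nat \<Rightarrow> int) (d_in :: nat \<Rightarrow> nat \<Rightarrow> int).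
      \<forall>i \<le> digraph_diameter G. \<forall>j \<le> digraph_diameter G.
        \<forall>x \<in> verts G. \<forall>y \<in> out_sphere G i x.
          int (card (out_nbhd G y \<inter> out_sphere G j x)) = d_out i j \<and>
          int (card (in_nbhd G y \<inter> out_sphere G j x)) = d_in i j)"

definition adj_matrix :: "('v::finite, 'e) pre_digraph \<Rightarrow> real ^ 'v ^ 'v" where
  "adj_matrix G = (\<chi> x y. if x \<rightarrow>\<^bsub>G\<^esub> y then 1 else 0)"

definition dist_matrix :: "('v::finite, 'e) pre_digraph \<Rightarrow> nat \<Rightarrow> real ^ 'v ^ 'v" where
  "dist_matrix G i = (\<chi> x y. if ddist G x y = i then 1 else 0)"

text \<open>
  The overloaded \<open>^\<close> and \<open>*\<close> on vectors and matrices act componentwise, so powers for the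
  matrix product and the evaluation of a polynomial at a matrix are defined here.
\<close>

primrec matrix_power :: "real ^ 'n ^ 'n \<Rightarrow> nat \<Rightarrow> real ^ 'n ^ 'n" where
  "matrix_power M 0 = mat 1"
| "matrix_power M (Suc k) = M ** matrix_power M k"

definition poly_matrix :: "real poly \<Rightarrow> real ^ 'n ^ 'n \<Rightarrow> real ^ 'n ^ 'n" where
  "poly_matrix p M = (\<Sum>k\<le>degree p. coeff p k *\<^sub>R matrix_power M k)"

end

theory Submission
  imports Defs
begin

text \<open>
  The matrices that are constant on the distance classes form the span of
  \<open>A\<^sub>0, \<dots>, A\<^sub>D\<close>, and distance-regularity says exactly that this span is closed under
  right multiplication by \<open>A\<close> and by its transpose.

  If \<open>\<Gamma>\<close> is distance-regular, the recurrence for \<open>A\<^sub>j A\<close> yields the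
  polynomials \<open>p\<^sub>j\<close>. Since the span contains all powers of the transpose of \<open>A\<close>, it contains
  \<open>A\<^sub>m\<^sup>\<top> = p\<^sub>m(A\<^sup>\<top>)\<close>. If \<open>x \<rightarrow> y\<close> is an arc and \<open>m = \<partial>(y, x)\<close>, then \<open>A\<^sub>m\<^sup>\<top>\<close> has
  the entry 1 at \<open>(x, y)\<close> and therefore on all arcs, which forces \<open>A\<^sup>\<top> = A\<^sub>m\<close>.

  Conversely, \<open>p\<^sub>k\<close> has degree exactly \<open>k\<close>, so that \<open>A\<^sup>k\<close> lies in the span for \<open>k \<le> D\<close>. Hence
  so does \<open>A\<^sub>j A\<close> for \<open>j < D\<close>. The sum \<open>J\<close> of all \<open>A\<^sub>i\<close> is a polynomial in \<open>A\<close> and thus commutes with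
  it, so \<open>J A\<close> is a multiple of \<open>J\<close>, which settles \<open>A\<^sub>D A\<close>. The span is therefore closed under
  multiplication by all polynomials in \<open>A\<close>, the matrix \<open>A\<^sup>\<top> = A\<^sub>m\<close> among them.
\<close>

section \<open>Polynomials of matrices\<close>

lemma linear_matrix_mul_left: "linear (\<lambda>M :: real ^ 'n ^ 'm. M ** (B :: real ^ 'k ^ 'n))"
  by (rule linearI)
     (simp_all add: matrix_matrix_mult_def vec_eq_iff distrib_right sum.distrib sum_distrib_left mult.assoc)

lemma linear_matrix_mul_right: "linear (\<lambda>M :: real ^ 'k ^ 'n. (B :: real ^ 'n ^ 'm) ** M)"
  by (rule linearI)
     (simp_all add: matrix_matrix_mult_def vec_eq_iff distrib_left sum.distrib sum_distrib_left mult.left_commute)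

lemma linear_transpose: "linear (transpose :: real ^ 'n ^ 'm \<Rightarrow> real ^ 'm ^ 'n)"
  by (rule linearI) (simp_all add: transpose_def vec_eq_iff)

text \<open>\<open>matrix_power\<close> adds factors on the left. Splitting one off on the right
  matches appending an arc to a walk, and transposition needs it because it reverses
  products.\<close>

lemma matrix_power_commute: "matrix_power M k ** M = M ** matrix_power M k"
  by (induction k) (simp_all add: matrix_mul_assoc [symmetric])

lemma transpose_matrix_power: "transpose (matrix_power M k) = matrix_power (transpose M) k"
  by (induction k) (simp_all add: matrix_transpose_mul matrix_power_commute)

text \<open>Padding with zero coefficients gives polynomials of different degrees a common summation
  range.\<close>

lemma poly_matrix_eq_sum:
  assumes "degree p \<le> n"
  shows "poly_matrix p M = (\<Sum>k\<le>n. coeff p k *\<^sub>R matrix_power M k)"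
  unfolding poly_matrix_def using assms
  by (intro sum.mono_neutral_left) (auto simp: coeff_eq_0)

lemma poly_matrix_0: "poly_matrix 0 M = 0"
  by (simp add: poly_matrix_def)

lemma poly_matrix_1: "poly_matrix 1 M = mat 1"
  by (simp add: poly_matrix_def)

lemma poly_matrix_add: "poly_matrix (p + q) M = poly_matrix p M + poly_matrix q M"
proof -
  define n where "n = max (degree p) (degree q)"
  have "degree p \<le> n" "degree q \<le> n" "degree (p + q) \<le> n"
    by (auto simp: n_def degree_add_le_max)
  then show ?thesis
    by (simp add: poly_matrix_eq_sum scaleR_add_left sum.distrib)
qed

lemma poly_matrix_smult: "poly_matrix (smult c p) M = c *\<^sub>R poly_matrix p M"
  by (simp add: poly_matrix_eq_sum [of "smult c p" "degree p"] degree_smult_le poly_matrix_def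
      scaleR_sum_right)

lemma poly_matrix_diff: "poly_matrix (p - q) M = poly_matrix p M - poly_matrix q M"
  using poly_matrix_add [of p "smult (-1) q" M] poly_matrix_smult [of "-1" q M] by simp

lemma poly_matrix_sum: "poly_matrix (\<Sum>i\<in>I. p i) M = (\<Sum>i\<in>I. poly_matrix (p i) M)"
  by (induction I rule: infinite_finite_induct) (simp_all add: poly_matrix_0 poly_matrix_add)

lemma poly_matrix_mul_right:
  "poly_matrix p M ** M = (\<Sum>k\<le>degree p. coeff p k *\<^sub>R matrix_power M (Suc k))"
  unfolding poly_matrix_def
  by (simp add: linear_sum [OF linear_matrix_mul_left] linear_scale [OF linear_matrix_mul_left]
      matrix_power_commute)

lemma poly_matrix_commute: "poly_matrix p M ** M = M ** poly_matrix p M"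
  unfolding poly_matrix_mul_right
  by (simp add: poly_matrix_def linear_sum [OF linear_matrix_mul_right]
      linear_scale [OF linear_matrix_mul_right])

lemma poly_matrix_pCons: "poly_matrix (pCons 0 p) M = poly_matrix p M ** M"
  unfolding poly_matrix_mul_right
  by (simp add: poly_matrix_eq_sum [OF degree_pCons_le] sum.atMost_Suc_shift del: sum.atMost_Suc)

lemma transpose_poly_matrix: "transpose (poly_matrix p M) = poly_matrix p (transpose M)"
  unfolding poly_matrix_def
  by (simp add: linear_sum [OF linear_transpose] linear_scale [OF linear_transpose]
      transpose_matrix_power)

section \<open>Distances in strongly connected digraphs\<close>

locale strong_digraph = digraph G for G :: "('v::finite, 'e) pre_digraph" +
  assumes verts_UNIV: "verts G = UNIV"
    and strong: "strongly_connected G"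
begin

abbreviation "diam \<equiv> digraph_diameter G"
abbreviation "adj \<equiv> adj_matrix G"
abbreviation "dmat \<equiv> dist_matrix G"

lemma ddist_le_length: "awalk x p y \<Longrightarrow> ddist G x y \<le> length p"
  unfolding ddist_def by (auto intro: Least_le)

lemma shortest_awalk:
  obtains p where "awalk x p y" "length p = ddist G x y"
proof -
  have "x \<rightarrow>\<^sup>*\<^bsub>G\<^esub> y"
    using strong verts_UNIV by (auto simp: strongly_connected_def)
  then have "\<exists>n p. awalk x p y \<and> length p = n"
    by (simp add: reachable_awalk)
  from LeastI_ex [OF this] show ?thesis
    using that unfolding ddist_def by blast
qed

lemma ddist_eq_0_iff: "ddist G x y = 0 \<longleftrightarrow> x = y"
proof
  assume "ddist G x y = 0"
  with shortest_awalk [of x y] show "x = y"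
    by (metis awalk_empty_ends length_0_conv)
next
  assume "x = y"
  then show "ddist G x y = 0"
    using ddist_le_length [of x "[]" y] by (simp add: awalk_Nil_iff verts_UNIV)
qed

lemma ddist_step: "y \<rightarrow>\<^bsub>G\<^esub> z \<Longrightarrow> ddist G x z \<le> Suc (ddist G x y)"
proof -
  assume "y \<rightarrow>\<^bsub>G\<^esub> z"
  then obtain e where e: "e \<in> arcs G" "tail G e = y" "head G e = z" by auto
  obtain p where p: "awalk x p y" "length p = ddist G x y" by (rule shortest_awalk)
  have "awalk y [e] z" using e arc_implies_awalk by blast
  with p(1) have "awalk x (p @ [e]) z" by (rule awalk_appendI)
  from ddist_le_length [OF this] p(2) show ?thesis by simp
qed

text \<open>The witness is the penultimate vertex of a shortest walk.\<close>

lemma ddist_Suc_obtain: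
  assumes "ddist G x y = Suc j"
  obtains z where "z \<rightarrow>\<^bsub>G\<^esub> y" "ddist G x z = j"
proof -
  obtain p where p: "awalk x p y" "length p = Suc j"
    using assms by (metis shortest_awalk)
  then obtain q e where q: "p = q @ [e]" "length q = j"
    by (metis length_Suc_conv_rev)
  have w: "awalk x q (tail G e)" and e: "e \<in> arcs G" "head G e = y"
    using p(1) q(1) by (auto simp: awalk_simps)
  have "tail G e \<rightarrow>\<^bsub>G\<^esub> y"
    using e in_arcs_imp_in_arcs_ends by blast
  \<comment> \<open>The initial part of the walk bounds the distance above by \<open>j\<close>;
    \<open>ddist_step\<close> bounds it below.\<close>
  moreover from ddist_step [OF this] have "ddist G x (tail G e) = j"
    using ddist_le_length [OF w] q(2) assms by (metis Suc_le_mono le_antisym)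
  ultimately show ?thesis by (rule that)
qed

lemma dominates_iff: "x \<rightarrow>\<^bsub>G\<^esub> y \<longleftrightarrow> ddist G x y = 1"
proof
  assume a: "x \<rightarrow>\<^bsub>G\<^esub> y"
  have "ddist G x y \<noteq> 0"
    using a adj_not_same by (auto simp: ddist_eq_0_iff)
  moreover have "ddist G x x = 0" by (simp add: ddist_eq_0_iff)
  ultimately show "ddist G x y = 1" using ddist_step [OF a, of x] by simp
next
  assume "ddist G x y = 1"
  then obtain z where "z \<rightarrow>\<^bsub>G\<^esub> y" "ddist G x z = 0"
    using ddist_Suc_obtain by (metis One_nat_def)
  then show "x \<rightarrow>\<^bsub>G\<^esub> y" by (simp add: ddist_eq_0_iff)
qed

lemma diam_eq: "diam = Max (range (\<lambda>(x, y). ddist G x y))"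
proof -
  have "{ddist G x y | x y. x \<in> verts G \<and> y \<in> verts G} = range (\<lambda>(x, y). ddist G x y)"
    by (auto simp: verts_UNIV)
  then show ?thesis by (simp add: digraph_diameter_def)
qed

lemma ddist_le_diam: "ddist G x y \<le> diam"
proof -
  have "ddist G x y \<in> range (\<lambda>(x, y). ddist G x y)" by auto
  then show ?thesis unfolding diam_eq by (intro Max_ge) simp_all
qed

lemma ddist_attained:
  assumes "i \<le> diam"
  obtains x y where "ddist G x y = i"
proof -
  have "\<exists>x y. ddist G x y = i"
    \<comment> \<open>Descend from a pair realising the diameter: a predecessor on a shortest walk
      lowers the distance by one.\<close>
    using assms
  proof (induction i rule: inc_induct)
    case base
    have "diam \<in> range (\<lambda>(x, y). ddist G x y)"
      unfolding diam_eq by (rule Max_in) simp_all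
    then show ?case by force
  next
    case (step i)
    then show ?case by (metis ddist_Suc_obtain)
  qed
  with that show ?thesis by blast
qed

section \<open>Matrices constant on the distance classes\<close>

text \<open>This is the span of the matrices \<open>dmat i\<close>, described by entries so that
  membership can be tested without coefficients.\<close>

definition class_const :: "(real ^ 'v ^ 'v) set" where
  "class_const = {M. \<forall>x y u v. ddist G x y = ddist G u v \<longrightarrow> M $ x $ y = M $ u $ v}"

lemma class_constD:
  "M \<in> class_const \<Longrightarrow> ddist G x y = ddist G u v \<Longrightarrow> M $ x $ y = M $ u $ v"
  unfolding class_const_def by blast

lemma subspace_class_const: "subspace class_const"
proof (rule subspaceI)
  show "0 \<in> class_const"
    by (simp add: class_const_def)
next
  fix M N assume MN: "M \<in> class_const" "N \<in> class_const"
  have "(M + N) $ x $ y = (M + N) $ u $ v" if "ddist G x y = ddist G u v" for x y u v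
    using MN [THEN class_constD, OF that] by simp
  then show "M + N \<in> class_const" unfolding class_const_def by blast
next
  fix c M assume M: "M \<in> class_const"
  have "(c *\<^sub>R M) $ x $ y = (c *\<^sub>R M) $ u $ v" if "ddist G x y = ddist G u v" for x y u v
    using class_constD [OF M that] by simp
  then show "c *\<^sub>R M \<in> class_const" unfolding class_const_def by blast
qed

lemma dmat_in_class_const: "dmat i \<in> class_const"
  by (simp add: class_const_def dist_matrix_def)

lemma class_const_eq_sum:
  assumes "M \<in> class_const"
  obtains c where "M = (\<Sum>i\<le>diam. c i *\<^sub>R dmat i)"
    and "\<And>x y. M $ x $ y = c (ddist G x y)"
proof -
  \<comment> \<open>\<open>c i\<close> is the common entry at distance \<open>i\<close>. It is
    arbitrary if no pair has that distance, but then \<open>dmat i\<close> is zero.\<close>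
  define c where "c i = (SOME r. \<exists>x y. ddist G x y = i \<and> M $ x $ y = r)" for i
  have c: "M $ x $ y = c (ddist G x y)" for x y
  proof -
    have "\<exists>u v. ddist G u v = ddist G x y \<and> M $ u $ v = c (ddist G x y)"
      unfolding c_def by (rule someI_ex) blast
    then show ?thesis using class_constD [OF assms] by metis
  qed
  moreover have "M = (\<Sum>i\<le>diam. c i *\<^sub>R dmat i)"
    by (simp add: vec_eq_iff dist_matrix_def c ddist_le_diam if_distrib cong: if_cong)
  ultimately show ?thesis using that by blast
qed

lemma class_const_mul_right:
  assumes "\<And>j. j \<le> diam \<Longrightarrow> dmat j ** B \<in> class_const" "M \<in> class_const"
  shows "M ** B \<in> class_const"
proof -
  obtain c where "M = (\<Sum>i\<le>diam. c i *\<^sub>R dmat i)"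
    using assms(2) by (rule class_const_eq_sum)
  then have "M ** B = (\<Sum>i\<le>diam. c i *\<^sub>R (dmat i ** B))"
    by (simp add: linear_sum [OF linear_matrix_mul_left] linear_scale [OF linear_matrix_mul_left])
  also have "\<dots> \<in> class_const"
    by (intro subspace_sum subspace_scale subspace_class_const assms(1)) simp
  finally show ?thesis .
qed

text \<open>The induction generalises \<open>M\<close>, because associativity turns
  \<open>M ** (B ** N)\<close> into \<open>(M ** B) ** N\<close>.\<close>

lemma class_const_mul_power:
  assumes "\<And>M. M \<in> class_const \<Longrightarrow> M ** B \<in> class_const" "M \<in> class_const"
  shows "M ** matrix_power B k \<in> class_const"
  using assms(2) by (induction k arbitrary: M) (simp_all add: matrix_mul_assoc assms(1))

lemma class_const_mul_poly:
  assumes "\<And>M. M \<in> class_const \<Longrightarrow> M ** B \<in> class_const" "M \<in> class_const"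
  shows "M ** poly_matrix p B \<in> class_const"
  unfolding poly_matrix_def
  by (simp add: linear_sum [OF linear_matrix_mul_right] linear_scale [OF linear_matrix_mul_right]
      subspace_sum subspace_scale subspace_class_const class_const_mul_power assms)

lemma dmat_0: "dmat 0 = mat 1"
  by (simp add: dist_matrix_def mat_def vec_eq_iff ddist_eq_0_iff)

text \<open>The entry counts the intermediate vertices \<open>z\<close> at distance \<open>j\<close>
  from \<open>x\<close> that have an arc into \<open>y\<close>; with the transpose that arc is
  reversed.\<close>

lemma dmat_mul_adj:
  "(dmat j ** adj) $ x $ y = real (card (in_nbhd G y \<inter> out_sphere G j x))"
proof -
  have "in_nbhd G y \<inter> out_sphere G j x = {z. z \<rightarrow>\<^bsub>G\<^esub> y \<and> ddist G x z = j}"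
    by (auto simp: in_nbhd_def out_sphere_def verts_UNIV)
  moreover have "(dmat j ** adj) $ x $ y = (\<Sum>z\<in>UNIV. if z \<rightarrow>\<^bsub>G\<^esub> y \<and> ddist G x z = j then 1 else 0)"
    unfolding matrix_matrix_mult_def dist_matrix_def adj_matrix_def
    by (simp, intro sum.cong) auto
  ultimately show ?thesis by (simp add: sum.If_cases)
qed

lemma dmat_mul_transpose_adj:
  "(dmat j ** transpose adj) $ x $ y = real (card (out_nbhd G y \<inter> out_sphere G j x))"
proof -
  have "out_nbhd G y \<inter> out_sphere G j x = {z. y \<rightarrow>\<^bsub>G\<^esub> z \<and> ddist G x z = j}"
    by (auto simp: out_nbhd_def out_sphere_def verts_UNIV)
  moreover have "(dmat j ** transpose adj) $ x $ y
      = (\<Sum>z\<in>UNIV. if y \<rightarrow>\<^bsub>G\<^esub> z \<and> ddist G x z = j then 1 else 0)"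
    unfolding matrix_matrix_mult_def dist_matrix_def adj_matrix_def transpose_def
    by (simp, intro sum.cong) auto
  ultimately show ?thesis by (simp add: sum.If_cases)
qed

lemma distance_regular_iff:
  "distance_regular G \<longleftrightarrow>
    (\<forall>j\<le>diam. dmat j ** adj \<in> class_const \<and> dmat j ** transpose adj \<in> class_const)"
    (is "_ \<longleftrightarrow> ?R")
proof
  assume "distance_regular G"
  then obtain d_out d_in :: "nat \<Rightarrow> nat \<Rightarrow> int" where
    d: "\<And>i j x y. i \<le> diam \<Longrightarrow> j \<le> diam \<Longrightarrow> ddist G x y = i \<Longrightarrow>
        int (card (out_nbhd G y \<inter> out_sphere G j x)) = d_out i j \<and>
        int (card (in_nbhd G y \<inter> out_sphere G j x)) = d_in i j"
    unfolding distance_regular_def out_sphere_def verts_UNIV by blast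
  show ?R
    unfolding class_const_def mem_Collect_eq dmat_mul_adj dmat_mul_transpose_adj of_nat_eq_iff
    using d [OF ddist_le_diam _ refl] by (metis of_nat_eq_iff)
next
  assume R: ?R
  \<comment> \<open>A representative pair at distance \<open>i\<close>; the intersection numbers are
    read off there. Only attained distances matter.\<close>
  define pair where "pair i = (SOME p. ddist G (fst p) (snd p) = i)" for i
  have pair: "ddist G (fst (pair (ddist G x y))) (snd (pair (ddist G x y))) = ddist G x y" for x y
    unfolding pair_def by (rule someI [of _ "(x, y)"]) simp
  show "distance_regular G"
    unfolding distance_regular_def
  proof (intro exI allI impI ballI)
    fix i j x y
    assume "j \<le> diam" "y \<in> out_sphere G i x"
    then have i: "i = ddist G x y" and c: "dmat j ** adj \<in> class_const"
        "dmat j ** transpose adj \<in> class_const"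
      using R by (auto simp: out_sphere_def)
    show "int (card (out_nbhd G y \<inter> out_sphere G j x)) =
        int (card (out_nbhd G (snd (pair i)) \<inter> out_sphere G j (fst (pair i)))) \<and>
      int (card (in_nbhd G y \<inter> out_sphere G j x)) =
        int (card (in_nbhd G (snd (pair i)) \<inter> out_sphere G j (fst (pair i))))"
      unfolding i using class_constD [OF c(1) pair] class_constD [OF c(2) pair]
      by (simp add: dmat_mul_adj dmat_mul_transpose_adj)
  qed
qed

section \<open>Distance-regularity and polynomials in the adjacency matrix\<close>

text \<open>The expansion of \<open>dmat n ** adj\<close> stops at index \<open>n + 1\<close> with a
  nonzero coefficient, so it can be solved for \<open>dmat (Suc n)\<close>.\<close>

lemma distance_regular_imp_poly:
  assumes adj: "\<And>j. j \<le> diam \<Longrightarrow> dmat j ** adj \<in> class_const"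
  shows "j \<le> diam \<Longrightarrow> \<exists>p. degree p \<le> j \<and> dmat j = poly_matrix p adj"
proof (induction j rule: less_induct)
  case (less j)
  show ?case
  proof (cases j)
    case 0
    then show ?thesis by (auto simp: dmat_0 poly_matrix_1 intro!: exI [of _ 1])
  next
    case (Suc n)
    then have n: "n < diam" using less.prems by simp
    have "\<forall>i\<in>{..n}. \<exists>p. degree p \<le> i \<and> dmat i = poly_matrix p adj"
      using less Suc by simp
    then obtain p where p: "\<And>i. i \<le> n \<Longrightarrow> degree (p i) \<le> i \<and> dmat i = poly_matrix (p i) adj"
      by (metis atMost_iff)
    obtain c where M: "dmat n ** adj = (\<Sum>i\<le>diam. c i *\<^sub>R dmat i)"
      and c: "\<And>x y. (dmat n ** adj) $ x $ y = c (ddist G x y)"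
      using class_const_eq_sum [OF adj [OF less_imp_le [OF n]]] by blast
    \<comment> \<open>An arc raises the distance from \<open>x\<close> by at most one, so none leads
      from distance \<open>n\<close> to distance \<open>i > n + 1\<close>.\<close>
    have c0: "c i = 0" if "Suc n < i" "i \<le> diam" for i
    proof -
      obtain x y where xy: "ddist G x y = i" using \<open>i \<le> diam\<close> by (rule ddist_attained)
      have "in_nbhd G y \<inter> out_sphere G n x = {}"
        using ddist_step [of _ y x] xy that by (fastforce simp: in_nbhd_def out_sphere_def)
      then show ?thesis using c [of x y] xy by (simp add: dmat_mul_adj)
    qed
    \<comment> \<open>A shortest walk of length \<open>n + 1\<close> passes through distance
      \<open>n\<close> just before its end.\<close>
    have c1: "c (Suc n) \<noteq> 0"
    proof -
      obtain x y where xy: "ddist G x y = Suc n"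
        using ddist_attained [of "Suc n"] n by auto
      obtain z where "z \<rightarrow>\<^bsub>G\<^esub> y" "ddist G x z = n"
        using xy by (rule ddist_Suc_obtain)
      then have "in_nbhd G y \<inter> out_sphere G n x \<noteq> {}"
        by (auto simp: in_nbhd_def out_sphere_def verts_UNIV)
      then have "real (card (in_nbhd G y \<inter> out_sphere G n x)) \<noteq> 0" by simp
      then show ?thesis using c [of x y] xy unfolding dmat_mul_adj by metis
    qed
    have "dmat n ** adj = (\<Sum>i\<le>Suc n. c i *\<^sub>R dmat i)"
      unfolding M using n c0 by (intro sum.mono_neutral_right) auto
    then have "c (Suc n) *\<^sub>R dmat (Suc n) = dmat n ** adj - (\<Sum>i\<le>n. c i *\<^sub>R dmat i)"
      by simp
    also have "\<dots> = poly_matrix (pCons 0 (p n) - (\<Sum>i\<le>n. smult (c i) (p i))) adj"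
      (is "_ = poly_matrix ?q adj")
      using p by (simp add: poly_matrix_diff poly_matrix_pCons poly_matrix_sum poly_matrix_smult)
    finally have q: "c (Suc n) *\<^sub>R dmat (Suc n) = poly_matrix ?q adj" .
    have "dmat (Suc n) = poly_matrix (smult (inverse (c (Suc n))) ?q) adj"
      using c1 by (simp add: poly_matrix_smult q [symmetric])
    moreover have "degree ?q \<le> Suc n"
    proof (intro degree_diff_le degree_sum_le)
      show "degree (pCons 0 (p n)) \<le> Suc n"
        using p [of n] degree_pCons_le [of 0 "p n"] by simp
      show "degree (smult (c i) (p i)) \<le> Suc n" if "i \<in> {..n}" for i
        using that p [of i] degree_smult_le [of "c i" "p i"] by simp
    qed simp
    ultimately show ?thesis
      using Suc degree_smult_le order_trans by metis
  qed
qed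

lemma distance_regular_imp_transpose:
  assumes diam: "diam \<ge> 1"
    and adj: "\<And>j. j \<le> diam \<Longrightarrow> dmat j ** adj \<in> class_const"
    and adjT: "\<And>j. j \<le> diam \<Longrightarrow> dmat j ** transpose adj \<in> class_const"
  obtains m where "m \<le> diam" "transpose adj = dmat m"
proof -
  \<comment> \<open>Positive diameter supplies an arc; \<open>m\<close> is the length of the way
    back along it.\<close>
  obtain x y where xy: "ddist G x y = 1" using diam by (rule ddist_attained)
  define m where "m = ddist G y x"
  have I: "mat 1 \<in> class_const" using dmat_in_class_const [of 0] by (simp add: dmat_0)
  have T: "M ** transpose adj \<in> class_const" if "M \<in> class_const" for M
    using adjT that by (rule class_const_mul_right)
  have AT: "transpose adj \<in> class_const" using T [OF I] by simp
  have m: "m \<le> diam" unfolding m_def by (rule ddist_le_diam)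
  obtain p where "dmat m = poly_matrix p adj"
    using distance_regular_imp_poly [OF adj] m by blast
  then have mT: "transpose (dmat m) \<in> class_const"
    using class_const_mul_poly [OF T I, of p] by (simp add: transpose_poly_matrix)
  \<comment> \<open>Forward, compare the entries of \<open>transpose (dmat m)\<close> at
    \<open>(v, u)\<close> and \<open>(x, y)\<close>; backward, those of \<open>transpose adj\<close>
    at \<open>(u, v)\<close> and \<open>(y, x)\<close>.\<close>
  have "v \<rightarrow>\<^bsub>G\<^esub> u \<longleftrightarrow> ddist G u v = m" for u v
  proof
    assume "v \<rightarrow>\<^bsub>G\<^esub> u"
    then have "ddist G v u = ddist G x y" by (simp add: dominates_iff xy)
    from class_constD [OF mT this] show "ddist G u v = m"
      by (simp add: transpose_def dist_matrix_def m_def split: if_splits)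
  next
    assume "ddist G u v = m"
    then have "ddist G u v = ddist G y x" by (simp add: m_def)
    from class_constD [OF AT this] show "v \<rightarrow>\<^bsub>G\<^esub> u"
      using xy by (simp add: transpose_def adj_matrix_def dominates_iff split: if_splits)
  qed
  then have "transpose adj = dmat m"
    by (simp add: transpose_def adj_matrix_def dist_matrix_def vec_eq_iff)
  with m that show ?thesis by blast
qed

text \<open>Entries of the \<open>k\<close>-th power count walks of length \<open>k\<close>, and
  these end at distance at most \<open>k\<close>.\<close>

lemma matrix_power_adj_eq_0: "k < ddist G x y \<Longrightarrow> matrix_power adj k $ x $ y = 0"
proof (induction k arbitrary: y)
  case 0
  then have "x \<noteq> y" using ddist_eq_0_iff by force
  then show ?case by (simp add: mat_def)
next
  case (Suc k)
  \<comment> \<open>Either \<open>z\<close> is farther than \<open>k\<close> and the first factor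
    vanishes, or it is too near to \<open>x\<close> to have an arc into \<open>y\<close>.\<close>
  have "matrix_power adj k $ x $ z * adj $ z $ y = 0" for z
    using Suc.IH [of z] ddist_step [of z y x] Suc.prems by (force simp: adj_matrix_def)
  then have "(matrix_power adj k ** adj) $ x $ y = 0"
    by (simp add: matrix_matrix_mult_def sum.neutral)
  then show ?case by (simp add: matrix_power_commute)
qed

text \<open>Solve \<open>dmat k = p k (adj)\<close> for its top power; the lower powers lie in the
  span by induction.\<close>

lemma power_in_class_const:
  assumes p: "\<And>i. i \<le> diam \<Longrightarrow> degree (p i) \<le> i \<and> dmat i = poly_matrix (p i) adj"
  shows "k \<le> diam \<Longrightarrow> matrix_power adj k \<in> class_const"
proof (induction k rule: less_induct)
  case (less k)
  define S where "S = (\<Sum>i<k. coeff (p k) i *\<^sub>R matrix_power adj i)"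
  have split: "dmat k = S + coeff (p k) k *\<^sub>R matrix_power adj k"
    using p [OF less.prems] unfolding S_def
    by (simp add: poly_matrix_eq_sum [of _ k] lessThan_Suc_atMost [symmetric])
  obtain x y where xy: "ddist G x y = k" using less.prems by (rule ddist_attained)
  \<comment> \<open>At distance \<open>k\<close> all lower powers vanish while \<open>dmat k\<close>
    has entry 1, so the top coefficient must be nonzero.\<close>
  have "S $ x $ y = 0"
    using xy by (simp add: S_def matrix_power_adj_eq_0)
  moreover have "dmat k $ x $ y = 1" using xy by (simp add: dist_matrix_def)
  ultimately have nz: "coeff (p k) k \<noteq> 0" using split by auto
  have "S \<in> class_const"
    unfolding S_def using less
    by (intro subspace_sum subspace_scale subspace_class_const less.IH) auto
  then have "inverse (coeff (p k) k) *\<^sub>R (dmat k - S) \<in> class_const"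
    by (intro subspace_scale subspace_diff subspace_class_const dmat_in_class_const)
  then show ?case using split nz by simp
qed

lemma poly_imp_mul_adj_class_const:
  assumes p: "\<And>i. i \<le> diam \<Longrightarrow> degree (p i) \<le> i \<and> dmat i = poly_matrix (p i) adj"
    and j: "j \<le> diam"
  shows "dmat j ** adj \<in> class_const"
proof -
  \<comment> \<open>The product involves powers up to \<open>i + 1\<close> only, which still do not
    exceed \<open>diam\<close>.\<close>
  have small: "dmat i ** adj \<in> class_const" if "i < diam" for i
  proof -
    have pi: "degree (p i) \<le> i" "dmat i = poly_matrix (p i) adj" using p that by auto
    show ?thesis
      unfolding pi(2) poly_matrix_mul_right using pi(1) that
      by (intro subspace_sum subspace_scale subspace_class_const power_in_class_const [OF p]) auto
  qed
  have "dmat diam ** adj \<in> class_const"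
  proof -
    \<comment> \<open>For \<open>i = diam\<close> the degree may exceed \<open>diam\<close>, so the
      last product is obtained by subtraction from \<open>J ** adj\<close>, with \<open>J\<close>
      the all-ones matrix.\<close>
    define J where "J = (\<Sum>i\<le>diam. dmat i)"
    have J1: "J $ x $ y = 1" for x y
      by (simp add: J_def dist_matrix_def ddist_le_diam)
    have "J ** adj = adj ** J"
      unfolding J_def using p
      by (simp add: linear_sum [OF linear_matrix_mul_left] linear_sum [OF linear_matrix_mul_right]
          poly_matrix_commute)
    then have "(J ** adj) $ x $ y = (adj ** J) $ x $ y" for x y by simp
    \<comment> \<open>Every column sum equals every row sum, since \<open>x\<close> and
      \<open>y\<close> vary independently. All column sums therefore agree and
      \<open>J ** adj\<close> is constant.\<close>
    then have JA: "(\<Sum>z\<in>UNIV. adj $ z $ y) = (\<Sum>z\<in>UNIV. adj $ x $ z)" for x y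
      by (simp add: matrix_matrix_mult_def J1)
    have "(J ** adj) $ x $ y = (J ** adj) $ u $ v" for x y u v
      using JA [of y x] JA [of v x] by (simp add: matrix_matrix_mult_def J1)
    then have "J ** adj \<in> class_const" unfolding class_const_def by blast
    moreover have "(\<Sum>i<diam. dmat i ** adj) \<in> class_const"
      using small by (intro subspace_sum subspace_class_const) auto
    ultimately have "J ** adj - (\<Sum>i<diam. dmat i ** adj) \<in> class_const"
      by (intro subspace_diff subspace_class_const)
    also have "J ** adj - (\<Sum>i<diam. dmat i ** adj) = dmat diam ** adj"
      unfolding J_def linear_sum [OF linear_matrix_mul_left] by (simp add: lessThan_Suc_atMost [symmetric])
    finally show ?thesis .
  qed
  with small j show ?thesis by (cases "j = diam") auto
qed

end

text \<open>Positive diameter excludes the single vertex, which is distance-regular although its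
  zero adjacency matrix differs from \<open>dmat 0 = mat 1\<close>.\<close>

theorem theorem7p1:
  fixes G :: "('v::finite, 'e) pre_digraph"
  assumes "digraph G"
    and "verts G = UNIV"
    and "strongly_connected G"
    and "digraph_diameter G \<ge> 1"
  shows "distance_regular G \<longleftrightarrow>
    transpose (adj_matrix G) \<in> {dist_matrix G i | i. i \<le> digraph_diameter G} \<and>
    (\<exists>p :: nat \<Rightarrow> real poly. \<forall>i \<le> digraph_diameter G.
       degree (p i) \<le> i \<and> dist_matrix G i = poly_matrix (p i) (adj_matrix G))"
    (is "_ \<longleftrightarrow> ?T \<and> ?P")
proof -
  interpret strong_digraph G
    using assms(1-3) by (intro strong_digraph.intro strong_digraph_axioms.intro)
  show ?thesis
    unfolding distance_regular_iff
  proof (intro iffI)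
    assume R: "\<forall>j\<le>diam. dmat j ** adj \<in> class_const \<and> dmat j ** transpose adj \<in> class_const"
    obtain m where "m \<le> diam" "transpose adj = dmat m"
      using distance_regular_imp_transpose [OF assms(4)] R by blast
    \<comment> \<open>The bound on \<open>i\<close> is placed under the existential so that choice
      gives one total family of polynomials.\<close>
    moreover have "\<forall>i. \<exists>p. i \<le> diam \<longrightarrow> degree p \<le> i \<and> dmat i = poly_matrix p adj"
      using distance_regular_imp_poly R by blast
    then have ?P by (rule choice [THEN exE]) blast
    ultimately show "?T \<and> ?P" by blast
  next
    assume "?T \<and> ?P"
    then obtain m p where m: "m \<le> diam" "transpose adj = dmat m"
      and p: "\<And>i. i \<le> diam \<Longrightarrow> degree (p i) \<le> i \<and> dmat i = poly_matrix (p i) adj"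
      by blast
    note A = poly_imp_mul_adj_class_const [OF p]
    \<comment> \<open>\<open>transpose adj\<close> is itself the polynomial \<open>p m\<close> in
      \<open>adj\<close>, so closure under \<open>adj\<close> suffices.\<close>
    have "dmat j ** poly_matrix (p m) adj \<in> class_const" for j
      by (rule class_const_mul_poly [OF class_const_mul_right [OF A] dmat_in_class_const])
    then show "\<forall>j\<le>diam. dmat j ** adj \<in> class_const \<and> dmat j ** transpose adj \<in> class_const"
      using A m p by metis
  qed
qed

end
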